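(* For every integer $n\ge 2$, the sequence $(A_l(n))_{l\ge 0}$ is the binomial transform of $(a_l(n))_{l\ge 0}$, $(B_l(n))_{l\ge 0}$ is the binomial transform of $(b_l(n))_{l\ge 0}$, $(\tilde A_l(n))_{l\ge 0}$ is the binomial transform of $(\tilde a_l(n))_{l\ge 0}$, and $(\tilde B_l(n))_{l\ge 0}$ is the binomial transform of $(\tilde b_l(n))_{l\ge 0}$.
   Context: A sequence $(\Phi_l)_{l\ge 0}$ is the binomial transform of $(\phi_l)_{l\ge 0}$ if $\Phi_l=\sum_{i=0}^{l}\binom{l}{i}\phi_i$ for all $l\ge 0$. For an integer $l\ge 1$, an $l$-colored part is a pair $(d,c)$ with $d\ge 2$ an integer (its value) and $c\in\{1,\dots,l\}$ (its color). An unordered (respectively ordered) $l$-colored factorization of an integer $n\ge 2$ is a finite multiset (respectively finite sequence) of $l$-colored parts whose values (with multiplicity) have product $n$ (one-part factorizations are included). It is called distinct if no pair $(d,c)$ occurs more than once. For $l\ge 1$ and $n\ge 2$: $A_l(n)$, $B_l(n)$, $\tilde A_l(n)$, $\tilde B_l(n)$ are, respectively, the numbers of unordered, distinct unordered, ordered, and distinct ordered $l$-colored factorizations of $n$ (so at most $l$ colors are used). $a_l(n)$, $b_l(n)$, $\tilde a_l(n)$, $\tilde b_l(n)$ are the corresponding numbers of such factorizations that use exactly $l$ colors, i.e. in which each of the colors $1,\dots,l$ is the color of at least one part. For $l=0$ all eight functions are set equal to $0$. *)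

theory Defs
  imports Complex_Main "HOL-Library.Multiset"
begin

definition is_binomial_transform :: "(nat \<Rightarrow> 'a::comm_semiring_1) \<Rightarrow> (nat \<Rightarrow> 'a) \<Rightarrow> bool" where
  "is_binomial_transform \<Phi> \<phi> \<longleftrightarrow> (\<forall>l. \<Phi> l = (\<Sum>i=0..l. of_nat (l choose i) * \<phi> i))"

text \<open>A part is a pair (value, color).\<close>

definition colored_parts :: "nat \<Rightarrow> (nat \<times> nat) set" where
  "colored_parts l = {(d, c). d \<ge> 2 \<and> c \<in> {1..l}}"

definition unordered_factorizations :: "nat \<Rightarrow> nat \<Rightarrow> (nat \<times> nat) multiset set" where
  "unordered_factorizations l n =
     {M. set_mset M \<subseteq> colored_parts l \<and> prod_mset (image_mset fst M) = n}"

definition ordered_factorizations :: "nat \<Rightarrow> nat \<Rightarrow> (nat \<times> nat) list set" where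
  "ordered_factorizations l n =
     {xs. set xs \<subseteq> colored_parts l \<and> prod_list (map fst xs) = n}"

definition distinct_unordered_factorizations :: "nat \<Rightarrow> nat \<Rightarrow> (nat \<times> nat) multiset set" where
  "distinct_unordered_factorizations l n =
     {M \<in> unordered_factorizations l n. \<forall>p. count M p \<le> 1}"

definition distinct_ordered_factorizations :: "nat \<Rightarrow> nat \<Rightarrow> (nat \<times> nat) list set" where
  "distinct_ordered_factorizations l n = {xs \<in> ordered_factorizations l n. distinct xs}"

definition uses_all_colors :: "nat \<Rightarrow> (nat \<times> nat) set \<Rightarrow> bool" where
  "uses_all_colors l P \<longleftrightarrow> (\<forall>c\<in>{1..l}. \<exists>p\<in>P. snd p = c)"

text \<open>
  Counting functions, intended for \<open>n \<ge> 2\<close>. All sets counted are finite: the values of the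
  parts are at least 2 and divide \<open>n\<close>, so both the number of parts and their values are bounded.
  Upper case counts factorizations with at most \<open>l\<close> colors, lower case those with exactly \<open>l\<close>
  colors; the suffix \<open>_ord\<close> stands for the tilde.
\<close>

definition A_count :: "nat \<Rightarrow> nat \<Rightarrow> nat" where
  "A_count l n = (if l = 0 then 0 else card (unordered_factorizations l n))"

definition B_count :: "nat \<Rightarrow> nat \<Rightarrow> nat" where
  "B_count l n = (if l = 0 then 0 else card (distinct_unordered_factorizations l n))"

definition A_count_ord :: "nat \<Rightarrow> nat \<Rightarrow> nat" where
  "A_count_ord l n = (if l = 0 then 0 else card (ordered_factorizations l n))"

definition B_count_ord :: "nat \<Rightarrow> nat \<Rightarrow> nat" where
  "B_count_ord l n = (if l = 0 then 0 else card (distinct_ordered_factorizations l n))"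

definition a_count :: "nat \<Rightarrow> nat \<Rightarrow> nat" where
  "a_count l n = (if l = 0 then 0 else
     card {M \<in> unordered_factorizations l n. uses_all_colors l (set_mset M)})"

definition b_count :: "nat \<Rightarrow> nat \<Rightarrow> nat" where
  "b_count l n = (if l = 0 then 0 else
     card {M \<in> distinct_unordered_factorizations l n. uses_all_colors l (set_mset M)})"

definition a_count_ord :: "nat \<Rightarrow> nat \<Rightarrow> nat" where
  "a_count_ord l n = (if l = 0 then 0 else
     card {xs \<in> ordered_factorizations l n. uses_all_colors l (set xs)})"

definition b_count_ord :: "nat \<Rightarrow> nat \<Rightarrow> nat" where
  "b_count_ord l n = (if l = 0 then 0 else
     card {xs \<in> distinct_ordered_factorizations l n. uses_all_colors l (set xs)})"

end

theory Submission
  imports Defs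
begin

text \<open>
  Sort the factorizations with colors among \<open>1, \<dots>, l\<close> by the set \<open>S\<close> of colors that they really
  use. A bijection from \<open>S\<close> to \<open>{1..i}\<close>, where \<open>i = card S\<close>, recolors the factorizations whose
  color set is \<open>S\<close> into those whose color set is \<open>{1..i}\<close>, and the inverse bijection undoes this.
  Hence each of the \<open>l choose i\<close> color sets of size \<open>i\<close> contributes the same number of
  factorizations, namely the number of those that use exactly the colors \<open>1, \<dots>, i\<close>; summing over
  \<open>i\<close> gives the binomial transform.

  The argument only needs objects that carry a set of colors and an action of recolorings, so
  it is carried out once, in \<open>card_eq_sum_over_color_sets\<close>. The four cases then need two things:
  there are finitely many factorizations for each \<open>l\<close>, and recoloring with a map injective on
  the colors used keeps a factorization distinct. The convention that the counts vanish at
  \<open>l = 0\<close> agrees with the actual counts, since the empty product is \<open>1\<close> and not \<open>n \<ge> 2\<close>.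
\<close>

section \<open>Counting objects by the set of their colors\<close>

text \<open>
  Recoloring along a bijection of color sets is a bijection of objects. The third assumption
  combines functoriality of recoloring with the fact that only the colors in use matter.
\<close>

lemma card_color_set_cong:
  fixes X :: "'x set" and colors :: "'x \<Rightarrow> 'c set" and recolor :: "('c \<Rightarrow> 'c) \<Rightarrow> 'x \<Rightarrow> 'x"
  assumes colors_recolor: "\<And>f x. colors (recolor f x) = f ` colors x"
    and recolor_closed: "\<And>f x. x \<in> X \<Longrightarrow> inj_on f (colors x) \<Longrightarrow> recolor f x \<in> X"
    and recolor_inverse:
      "\<And>f g x. (\<And>c. c \<in> colors x \<Longrightarrow> g (f c) = c) \<Longrightarrow> recolor g (recolor f x) = x"
    and "finite S" "finite T" "card S = card T"
  shows "card {x \<in> X. colors x = S} = card {x \<in> X. colors x = T}"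
proof -
  obtain f where f: "bij_betw f S T"
    using assms(4-6) finite_same_card_bij by blast
  define g where "g = inv_into S f"
  have g: "bij_betw g T S"
    unfolding g_def by (rule bij_betw_inv_into[OF f])
  have gf: "g (f c) = c" if "c \<in> S" for c
    using f that by (simp add: g_def bij_betw_inv_into_left)
  have fg: "f (g c) = c" if "c \<in> T" for c
    using f that by (simp add: g_def bij_betw_inv_into_right)
  have "bij_betw (recolor f) {x \<in> X. colors x = S} {x \<in> X. colors x = T}"
  proof (rule bij_betw_byWitness[where f' = "recolor g"])
    show "\<forall>x\<in>{x \<in> X. colors x = S}. recolor g (recolor f x) = x"
      using recolor_inverse gf by blast
    show "\<forall>x\<in>{x \<in> X. colors x = T}. recolor f (recolor g x) = x"
      using recolor_inverse fg by blast
    show "recolor f ` {x \<in> X. colors x = S} \<subseteq> {x \<in> X. colors x = T}"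
      using f colors_recolor recolor_closed by (auto simp: bij_betw_def)
    show "recolor g ` {x \<in> X. colors x = T} \<subseteq> {x \<in> X. colors x = S}"
      using g colors_recolor recolor_closed by (auto simp: bij_betw_def)
  qed
  then show ?thesis
    by (rule bij_betw_same_card)
qed

lemma card_eq_sum_over_color_sets:
  fixes X :: "'x set" and colors :: "'x \<Rightarrow> nat set" and recolor :: "(nat \<Rightarrow> nat) \<Rightarrow> 'x \<Rightarrow> 'x"
  assumes colors_recolor: "\<And>f x. colors (recolor f x) = f ` colors x"
    and recolor_closed: "\<And>f x. x \<in> X \<Longrightarrow> inj_on f (colors x) \<Longrightarrow> recolor f x \<in> X"
    and recolor_inverse:
      "\<And>f g x. (\<And>c. c \<in> colors x \<Longrightarrow> g (f c) = c) \<Longrightarrow> recolor g (recolor f x) = x"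
    and fin: "finite {x \<in> X. colors x \<subseteq> {1..l}}"
  shows "card {x \<in> X. colors x \<subseteq> {1..l}} =
    (\<Sum>i=0..l. (l choose i) * card {x \<in> X. colors x = {1..i}})"
proof -
  let ?E = "\<lambda>S. {x \<in> X. colors x = S}"
  let ?P = "\<lambda>i. {S. S \<subseteq> {1..l} \<and> card S = i}"
  have finE: "finite (?E S)" if "S \<in> Pow {1..l}" for S
    using that by (intro finite_subset[OF _ fin]) auto
  have "{x \<in> X. colors x \<subseteq> {1..l}} = (\<Union>S\<in>Pow {1..l}. ?E S)"
    by auto
  then have "card {x \<in> X. colors x \<subseteq> {1..l}} = card (\<Union>S\<in>Pow {1..l}. ?E S)"
    by simp
  also have "\<dots> = (\<Sum>S\<in>Pow {1..l}. card (?E S))"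
    by (rule card_UN_disjoint) (use finE in auto)
  also have "\<dots> = (\<Sum>i=0..l. \<Sum>S\<in>{S \<in> Pow {1..l}. card S = i}. card (?E S))"
  proof (rule sum.group[symmetric])
    show "card ` Pow {1..l} \<subseteq> {0..l}"
      using card_mono[of "{1..l}"] by auto
  qed auto
  also have "\<dots> = (\<Sum>i=0..l. \<Sum>S\<in>?P i. card (?E {1..i}))"
  proof (intro sum.cong refl)
    fix i S
    assume S: "S \<in> ?P i"
    have "finite S"
      using S finite_subset[of S "{1..l}"] by auto
    with S show "card (?E S) = card (?E {1..i})"
      by (intro card_color_set_cong[where recolor = recolor] assms) auto
  qed auto
  also have "\<dots> = (\<Sum>i=0..l. (l choose i) * card (?E {1..i}))"
    by (simp add: n_subsets)
  finally show ?thesis .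
qed

section \<open>Finiteness\<close>

lemma two_power_length_le_prod_list:
  fixes ds :: "nat list"
  assumes "\<And>d. d \<in> set ds \<Longrightarrow> 2 \<le> d"
  shows "2 ^ length ds \<le> prod_list ds"
  using assms by (induction ds) (auto intro: mult_le_mono)

text \<open>
  Both the values of the parts and the number of parts are at most \<open>n\<close>: the values because they
  divide \<open>n\<close>, their number \<open>k\<close> because \<open>k < 2 ^ k \<le> n\<close>.
\<close>

lemma finite_ordered_factorizations:
  assumes "n > 0"
  shows "finite (ordered_factorizations l n)"
proof (rule finite_subset)
  show "ordered_factorizations l n \<subseteq>
      {xs. set xs \<subseteq> {2..n} \<times> {1..l} \<and> length xs \<le> n}"
  proof
    fix xs
    assume "xs \<in> ordered_factorizations l n"
    then have xs: "set xs \<subseteq> colored_parts l" and prod: "prod_list (map fst xs) = n"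
      by (auto simp: ordered_factorizations_def)
    have "2 ^ length (map fst xs) \<le> prod_list (map fst xs)"
      by (rule two_power_length_le_prod_list) (use xs in \<open>auto simp: colored_parts_def\<close>)
    then have "2 ^ length xs \<le> n"
      using prod by simp
    then have "length xs \<le> n"
      by (rule order_trans[OF less_imp_le[OF less_exp]])
    moreover have "fst p \<le> n" if "p \<in> set xs" for p
    proof -
      have "fst p \<in> set (map fst xs)"
        using that by simp
      then have "fst p dvd n"
        unfolding prod[symmetric] by (rule prod_list_dvd)
      then show ?thesis
        using assms dvd_imp_le by blast
    qed
    ultimately show "xs \<in> {xs. set xs \<subseteq> {2..n} \<times> {1..l} \<and> length xs \<le> n}"
      using xs by (fastforce simp: colored_parts_def)
  qed
  show "finite {xs. set xs \<subseteq> {2..n} \<times> {1..l} \<and> length xs \<le> n}"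
    by (rule finite_lists_length_le) auto
qed

lemma finite_unordered_factorizations:
  assumes "n > 0"
  shows "finite (unordered_factorizations l n)"
proof (rule finite_subset)
  show "unordered_factorizations l n \<subseteq> mset ` ordered_factorizations l n"
  proof
    fix M
    assume M: "M \<in> unordered_factorizations l n"
    obtain xs where "mset xs = M"
      using ex_mset by blast
    with M show "M \<in> mset ` ordered_factorizations l n"
      by (intro image_eqI[of _ _ xs])
        (auto simp: unordered_factorizations_def ordered_factorizations_def
          simp flip: prod_mset_prod_list)
  qed
  show "finite (mset ` ordered_factorizations l n)"
    using finite_ordered_factorizations[OF assms] by blast
qed

section \<open>Recoloring factorizations\<close>

lemma inj_on_map_prod_id:
  assumes "inj_on f (snd ` P)"
  shows "inj_on (map_prod id f) P"
  using assms by (auto simp: inj_on_def image_iff)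

lemma count_image_mset_le_1:
  assumes "\<forall>p. count M p \<le> 1" and inj: "inj_on h (set_mset M)"
  shows "\<forall>q. count (image_mset h M) q \<le> 1"
proof
  fix q
  show "count (image_mset h M) q \<le> 1"
  proof (cases "q \<in> h ` set_mset M")
    case True
    then obtain p where p: "p \<in># M" "q = h p"
      by blast
    then have "h -` {q} \<inter> set_mset M = {p}"
      using inj by (auto dest: inj_onD)
    then show ?thesis
      using assms(1) by (simp add: count_image_mset)
  next
    case False
    then show ?thesis
      by (metis count_eq_zero_iff set_image_mset zero_le)
  qed
qed

text \<open>
  The predicate \<open>Q\<close> is either trivial or distinctness. The factorizations range over parts of
  arbitrary color, so that the number \<open>l\<close> of colors enters only through the color set.
\<close>

lemma card_ordered_factorizations_by_colors:
  fixes Q :: "(nat \<times> nat) list \<Rightarrow> bool"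
  assumes "n > 0"
    and Q_map: "\<And>h xs. Q xs \<Longrightarrow> inj_on h (set xs) \<Longrightarrow> Q (map h xs)"
  shows "card {xs \<in> ordered_factorizations l n. Q xs} =
    (\<Sum>i=0..l. (l choose i) *
      card {xs \<in> ordered_factorizations i n. Q xs \<and> uses_all_colors i (set xs)})"
proof -
  define X where "X = {xs. (\<forall>p\<in>set xs. 2 \<le> fst p) \<and> prod_list (map fst xs) = n \<and> Q xs}"
  define colors :: "(nat \<times> nat) list \<Rightarrow> nat set" where "colors xs = snd ` set xs" for xs
  define recolor :: "(nat \<Rightarrow> nat) \<Rightarrow> (nat \<times> nat) list \<Rightarrow> _"
    where "recolor f = map (map_prod id f)" for f
  have at_most: "{xs \<in> ordered_factorizations k n. Q xs} = {xs \<in> X. colors xs \<subseteq> {1..k}}" for k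
    by (fastforce simp: ordered_factorizations_def colored_parts_def X_def colors_def)
  have exactly: "{xs \<in> ordered_factorizations k n. Q xs \<and> uses_all_colors k (set xs)} =
      {xs \<in> X. colors xs = {1..k}}" for k
  proof -
    have "uses_all_colors k (set xs) \<longleftrightarrow> {1..k} \<subseteq> colors xs" for xs
      by (auto simp: uses_all_colors_def colors_def)
    with at_most[of k] show ?thesis
      by blast
  qed
  have "card {xs \<in> X. colors xs \<subseteq> {1..l}} =
      (\<Sum>i=0..l. (l choose i) * card {xs \<in> X. colors xs = {1..i}})"
  proof (rule card_eq_sum_over_color_sets[where recolor = recolor])
    show "colors (recolor f xs) = f ` colors xs" for f xs
      by (auto simp: colors_def recolor_def image_image)
    show "recolor f xs \<in> X" if "xs \<in> X" "inj_on f (colors xs)" for f xs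
      using that Q_map inj_on_map_prod_id
      by (auto simp: X_def colors_def recolor_def comp_def)
    show "recolor g (recolor f xs) = xs" if "\<And>c. c \<in> colors xs \<Longrightarrow> g (f c) = c" for f g xs
      using that by (force simp: colors_def recolor_def intro!: map_idI)
    show "finite {xs \<in> X. colors xs \<subseteq> {1..l}}"
      unfolding at_most[symmetric]
      using finite_ordered_factorizations[OF \<open>n > 0\<close>] by simp
  qed
  then show ?thesis
    unfolding at_most exactly .
qed

lemma card_unordered_factorizations_by_colors:
  fixes Q :: "(nat \<times> nat) multiset \<Rightarrow> bool"
  assumes "n > 0"
    and Q_image: "\<And>h M. Q M \<Longrightarrow> inj_on h (set_mset M) \<Longrightarrow> Q (image_mset h M)"
  shows "card {M \<in> unordered_factorizations l n. Q M} =
    (\<Sum>i=0..l. (l choose i) *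
      card {M \<in> unordered_factorizations i n. Q M \<and> uses_all_colors i (set_mset M)})"
proof -
  define X where
    "X = {M. (\<forall>p\<in>set_mset M. 2 \<le> fst p) \<and> prod_mset (image_mset fst M) = n \<and> Q M}"
  define colors :: "(nat \<times> nat) multiset \<Rightarrow> nat set" where "colors M = snd ` set_mset M" for M
  define recolor :: "(nat \<Rightarrow> nat) \<Rightarrow> (nat \<times> nat) multiset \<Rightarrow> _"
    where "recolor f = image_mset (map_prod id f)" for f
  have at_most: "{M \<in> unordered_factorizations k n. Q M} = {M \<in> X. colors M \<subseteq> {1..k}}" for k
    by (fastforce simp: unordered_factorizations_def colored_parts_def X_def colors_def)
  have exactly: "{M \<in> unordered_factorizations k n. Q M \<and> uses_all_colors k (set_mset M)} =
      {M \<in> X. colors M = {1..k}}" for k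
  proof -
    have "uses_all_colors k (set_mset M) \<longleftrightarrow> {1..k} \<subseteq> colors M" for M
      by (auto simp: uses_all_colors_def colors_def)
    with at_most[of k] show ?thesis
      by blast
  qed
  have "card {M \<in> X. colors M \<subseteq> {1..l}} =
      (\<Sum>i=0..l. (l choose i) * card {M \<in> X. colors M = {1..i}})"
  proof (rule card_eq_sum_over_color_sets[where recolor = recolor])
    show "colors (recolor f M) = f ` colors M" for f M
      by (auto simp: colors_def recolor_def image_image)
    show "recolor f M \<in> X" if "M \<in> X" "inj_on f (colors M)" for f M
      using that Q_image inj_on_map_prod_id
      by (auto simp: X_def colors_def recolor_def multiset.map_comp comp_def)
    show "recolor g (recolor f M) = M" if "\<And>c. c \<in> colors M \<Longrightarrow> g (f c) = c" for f g M
    proof -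
      have "recolor g (recolor f M) = image_mset id M"
        unfolding recolor_def multiset.map_comp
        by (rule image_mset_cong) (use that in \<open>force simp: colors_def\<close>)
      then show ?thesis
        by simp
    qed
    show "finite {M \<in> X. colors M \<subseteq> {1..l}}"
      unfolding at_most[symmetric]
      using finite_unordered_factorizations[OF \<open>n > 0\<close>] by simp
  qed
  then show ?thesis
    unfolding at_most exactly .
qed

section \<open>Binomial transforms\<close>

text \<open>
  The convention for \<open>l = 0\<close> needs \<open>n \<noteq> 1\<close>: the empty factorization of \<open>1\<close> uses no color.
\<close>

lemma factorizations_no_colors:
  assumes "n \<ge> 2"
  shows "unordered_factorizations 0 n = {}" "ordered_factorizations 0 n = {}"
  using assms
  by (auto simp: unordered_factorizations_def ordered_factorizations_def colored_parts_def)

theorem theorem12: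
  fixes n :: nat
  assumes "n \<ge> 2"
  shows "is_binomial_transform (\<lambda>l. A_count l n) (\<lambda>l. a_count l n)
       \<and> is_binomial_transform (\<lambda>l. B_count l n) (\<lambda>l. b_count l n)
       \<and> is_binomial_transform (\<lambda>l. A_count_ord l n) (\<lambda>l. a_count_ord l n)
       \<and> is_binomial_transform (\<lambda>l. B_count_ord l n) (\<lambda>l. b_count_ord l n)"
proof -
  let ?distinct = "\<lambda>M. \<forall>p. count M p \<le> 1"
  have pos: "n > 0"
    using assms by simp
  note empty = factorizations_no_colors[OF assms]
  have A: "A_count l n = card {M \<in> unordered_factorizations l n. True}"
    and a: "a_count l n =
      card {M \<in> unordered_factorizations l n. True \<and> uses_all_colors l (set_mset M)}"
    and B: "B_count l n = card {M \<in> unordered_factorizations l n. ?distinct M}"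
    and b: "b_count l n =
      card {M \<in> unordered_factorizations l n. ?distinct M \<and> uses_all_colors l (set_mset M)}"
    and A_ord: "A_count_ord l n = card {xs \<in> ordered_factorizations l n. True}"
    and a_ord: "a_count_ord l n =
      card {xs \<in> ordered_factorizations l n. True \<and> uses_all_colors l (set xs)}"
    and B_ord: "B_count_ord l n = card {xs \<in> ordered_factorizations l n. distinct xs}"
    and b_ord: "b_count_ord l n =
      card {xs \<in> ordered_factorizations l n. distinct xs \<and> uses_all_colors l (set xs)}" for l
    by (simp_all add: A_count_def a_count_def B_count_def b_count_def A_count_ord_def
        a_count_ord_def B_count_ord_def b_count_ord_def distinct_unordered_factorizations_def
        distinct_ordered_factorizations_def empty conj_assoc)
  have "is_binomial_transform (\<lambda>l. A_count l n) (\<lambda>l. a_count l n)"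
    unfolding is_binomial_transform_def of_nat_id A a
    by (intro allI card_unordered_factorizations_by_colors pos)
  moreover have "is_binomial_transform (\<lambda>l. B_count l n) (\<lambda>l. b_count l n)"
    unfolding is_binomial_transform_def of_nat_id B b
    by (intro allI card_unordered_factorizations_by_colors pos) (use count_image_mset_le_1 in blast)
  moreover have "is_binomial_transform (\<lambda>l. A_count_ord l n) (\<lambda>l. a_count_ord l n)"
    unfolding is_binomial_transform_def of_nat_id A_ord a_ord
    by (intro allI card_ordered_factorizations_by_colors pos)
  moreover have "is_binomial_transform (\<lambda>l. B_count_ord l n) (\<lambda>l. b_count_ord l n)"
    unfolding is_binomial_transform_def of_nat_id B_ord b_ord
    by (intro allI card_ordered_factorizations_by_colors pos) (simp add: distinct_map)
  ultimately show ?thesis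
    by blast
qed

end
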